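(* For every partial Boolean function $g\subseteq\{0,1\}^m\times\{0,1\}$, $\bar\chi(g)\ge\mathrm{RS}(g)$.
   Context: Partial Boolean function: $g^{-1}(b)$ is the set of $x$ with $(x,b)\in g$ and $(x,1-b)\notin g$; valid inputs are $g^{-1}(0)\cup g^{-1}(1)$. Max conflict complexity: a deterministic decision tree $T$ on $\{0,1\}^m$ queries index $q(v)$ at internal node $v$, moving to $v_0$ or $v_1$; it computes $g$ if it outputs $b$ on every $x\in g^{-1}(b)$; nodes are identified with the subcubes of inputs reaching them; $d_T(v)$ is the number of vertices on the root-to-$v$ path (root has $d_T=1$); $\pi(v)$ is the parent. For distributions $\mu_0,\mu_1$ with $\mathrm{supp}(\mu_b)\subseteq g^{-1}(b)$: $p_b(v)=\Pr_{x\sim\mu_b}[x_{q(v)}=0\mid x\in v]$, $\Delta(v)=|p_0(v)-p_1(v)|$, $R(\text{root})=1$, $R(v)=R(\pi(v))\min_b\Pr_{x\sim\mu_b}[x\in v\mid x\in\pi(v)]$ (terms with $R(v)=0$ contribute $0$), $\chi(T,(\mu_0,\mu_1))=\sum_v d_T(v)\Delta(v)R(v)$. For a distribution $\mathcal Q$ over such pairs, $\chi(T,\mathcal Q)=\mathbb E_{(\mu_0,\mu_1)\sim\mathcal Q}\chi(T,(\mu_0,\mu_1))$ and $\bar\chi(g)=\max_{\mathcal Q}\min_T\chi(T,\mathcal Q)$, minimum over deterministic trees computing $g$. Sabotage complexity: let $P^*\subseteq\{0,1,*\}^m$ be the set of strings $z$ for which there exist $x\in g^{-1}(0)$ and $y\in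 g^{-1}(1)$ both agreeing with $z$ on all non-$*$ coordinates; define $P^\dagger\subseteq\{0,1,\dagger\}^m$ analogously with the symbol $\dagger$. Let $g_{\mathrm{sab}}:P^*\cup P^\dagger\to\{*,\dagger\}$ map $z\in P^*$ to $*$ and $z\in P^\dagger$ to $\dagger$. Then $\mathrm{RS}(g)=\mathrm{R}_0(g_{\mathrm{sab}})$, where $\mathrm{R}_0$ is zero-error randomized query complexity: the minimum, over randomized query algorithms that always output the correct value on every input in the domain, of the maximum over inputs of the expected number of queries. *)

theory Defs
  imports "HOL-Probability.Probability"
begin

text \<open>Inputs in \<open>A\<^sup>m\<close> are lists of length \<open>m\<close>; for bits, \<open>False\<close> is 0 and \<open>True\<close> is 1.\<close>

definition strict_preimage :: "(bool list \<times> bool) set \<Rightarrow> bool \<Rightarrow> bool list set" where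
  "strict_preimage g b = {x. (x, b) \<in> g \<and> (x, \<not> b) \<notin> g}"

datatype ('a, 'o) dtree =
  is_Leaf: Leaf 'o
| Query (index: nat) (child: "'a \<Rightarrow> ('a, 'o) dtree")

primrec valid_dtree :: "nat \<Rightarrow> ('a, 'o) dtree \<Rightarrow> bool" where
  "valid_dtree m (Leaf b) \<longleftrightarrow> True"
| "valid_dtree m (Query i k) \<longleftrightarrow> i < m \<and> (\<forall>a. valid_dtree m (k a))"

primrec run :: "('a, 'o) dtree \<Rightarrow> 'a list \<Rightarrow> 'o" where
  "run (Leaf b) x = b"
| "run (Query i k) x = run (k (x ! i)) x"

primrec num_queries :: "('a, 'o) dtree \<Rightarrow> 'a list \<Rightarrow> nat" where
  "num_queries (Leaf b) x = 0"
| "num_queries (Query i k) x = Suc (num_queries (k (x ! i)) x)"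


subsection \<open>Max conflict complexity\<close>

text \<open>
  A vertex of a tree is addressed by the list of query answers on the path from the root to it,
  so the root is \<open>[]\<close> and the parent of a non-root vertex \<open>v\<close> is \<open>butlast v\<close>.
\<close>

primrec vertices :: "('a, 'o) dtree \<Rightarrow> 'a list set" where
  "vertices (Leaf b) = {[]}"
| "vertices (Query i k) = insert [] (\<Union>a. (#) a ` vertices (k a))"

fun subtree :: "('a, 'o) dtree \<Rightarrow> 'a list \<Rightarrow> ('a, 'o) dtree" where
  "subtree T [] = T"
| "subtree (Leaf b) (a # v) = Leaf b"
| "subtree (Query i k) (a # v) = subtree (k a) v"

definition internal_vertices :: "('a, 'o) dtree \<Rightarrow> 'a list set" where
  "internal_vertices T = {v \<in> vertices T. \<not> is_Leaf (subtree T v)}"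

definition query_at :: "('a, 'o) dtree \<Rightarrow> 'a list \<Rightarrow> nat" where
  "query_at T v = index (subtree T v)"

fun reaches :: "('a, 'o) dtree \<Rightarrow> 'a list \<Rightarrow> 'a list \<Rightarrow> bool" where
  "reaches T x [] \<longleftrightarrow> True"
| "reaches (Leaf b) x (a # v) \<longleftrightarrow> False"
| "reaches (Query i k) x (a # v) \<longleftrightarrow> x ! i = a \<and> reaches (k a) x v"

definition subcube :: "nat \<Rightarrow> ('a, 'o) dtree \<Rightarrow> 'a list \<Rightarrow> 'a list set" where
  "subcube m T v = {x. length x = m \<and> reaches T x v}"

definition vertex_depth :: "'a list \<Rightarrow> nat" where
  "vertex_depth v = length v + 1"

definition computes :: "nat \<Rightarrow> (bool, bool) dtree \<Rightarrow> (bool list \<times> bool) set \<Rightarrow> bool" where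
  "computes m T g \<longleftrightarrow> valid_dtree m T \<and> (\<forall>b. \<forall>x\<in>strict_preimage g b. run T x = b)"

text \<open>
  Conditioning on an event of probability 0 gives the value 0. This only happens at vertices
  \<open>v\<close> with \<open>conflict_R m T \<mu>\<^sub>0 \<mu>\<^sub>1 v = 0\<close>, which therefore contribute 0 to \<open>conflict_chi\<close>.
\<close>

definition prob_zero :: "nat \<Rightarrow> (bool, 'o) dtree \<Rightarrow> bool list measure \<Rightarrow> bool list \<Rightarrow> real" where
  "prob_zero m T \<mu> v = \<P>(x in \<mu>. x ! query_at T v = False \<bar> x \<in> subcube m T v)"

definition conflict_Delta ::
  "nat \<Rightarrow> (bool, 'o) dtree \<Rightarrow> bool list measure \<Rightarrow> bool list measure \<Rightarrow> bool list \<Rightarrow> real" where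
  "conflict_Delta m T \<mu>\<^sub>0 \<mu>\<^sub>1 v = \<bar>prob_zero m T \<mu>\<^sub>0 v - prob_zero m T \<mu>\<^sub>1 v\<bar>"

function conflict_R ::
  "nat \<Rightarrow> (bool, 'o) dtree \<Rightarrow> bool list measure \<Rightarrow> bool list measure \<Rightarrow> bool list \<Rightarrow> real" where
  "conflict_R m T \<mu>\<^sub>0 \<mu>\<^sub>1 v =
     (if v = [] then 1
      else conflict_R m T \<mu>\<^sub>0 \<mu>\<^sub>1 (butlast v) *
        min \<P>(x in \<mu>\<^sub>0. x \<in> subcube m T v \<bar> x \<in> subcube m T (butlast v))
            \<P>(x in \<mu>\<^sub>1. x \<in> subcube m T v \<bar> x \<in> subcube m T (butlast v)))"
  by pat_completeness auto
termination
  by (relation "Wellfounded.measure (\<lambda>(m, T, \<mu>\<^sub>0, \<mu>\<^sub>1, v). length v)") auto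

declare conflict_R.simps [simp del]

definition conflict_chi ::
  "nat \<Rightarrow> (bool, 'o) dtree \<Rightarrow> bool list measure \<Rightarrow> bool list measure \<Rightarrow> real" where
  "conflict_chi m T \<mu>\<^sub>0 \<mu>\<^sub>1 =
     (\<Sum>v\<in>internal_vertices T.
        real (vertex_depth v) * conflict_Delta m T \<mu>\<^sub>0 \<mu>\<^sub>1 v * conflict_R m T \<mu>\<^sub>0 \<mu>\<^sub>1 v)"

text \<open>
  The measurable space of pairs \<open>(\<mu>\<^sub>0, \<mu>\<^sub>1)\<close> of distributions with the support of \<open>\<mu>\<^sub>b\<close> contained
  in \<open>strict_preimage g b\<close>.
\<close>

definition distribution_pairs ::
  "(bool list \<times> bool) set \<Rightarrow> (bool list measure \<times> bool list measure) measure" where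
  "distribution_pairs g =
     prob_algebra (count_space (strict_preimage g False)) \<Otimes>\<^sub>M
     prob_algebra (count_space (strict_preimage g True))"

definition conflict_chi_avg ::
  "nat \<Rightarrow> (bool, 'o) dtree \<Rightarrow> (bool list measure \<times> bool list measure) measure \<Rightarrow> ennreal" where
  "conflict_chi_avg m T Q = (\<integral>\<^sup>+ (\<mu>\<^sub>0, \<mu>\<^sub>1). ennreal (conflict_chi m T \<mu>\<^sub>0 \<mu>\<^sub>1) \<partial>Q)"

text \<open>
  If one of the two preimages is empty, there are no distributions \<open>Q\<close> and the supremum in
  \<^typ>\<open>ennreal\<close> is 0.
\<close>

definition max_conflict :: "nat \<Rightarrow> (bool list \<times> bool) set \<Rightarrow> ennreal" where
  "max_conflict m g =
     (SUP Q \<in> space (prob_algebra (distribution_pairs g)).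
        INF T \<in> {T. computes m T g}. conflict_chi_avg m T Q)"


subsection \<open>Sabotage complexity\<close>

text \<open>
  A randomized algorithm is a distribution over deterministic trees. For a finite alphabet and
  countably many outputs there are only countably many trees, so every distribution is a
  \<^type>\<open>pmf\<close>.
\<close>

definition zero_error :: "nat \<Rightarrow> ('a list \<rightharpoonup> 'o) \<Rightarrow> ('a, 'o) dtree pmf \<Rightarrow> bool" where
  "zero_error m f A \<longleftrightarrow>
     (\<forall>T\<in>set_pmf A. valid_dtree m T \<and> (\<forall>z\<in>dom f. f z = Some (run T z)))"

definition R0 :: "nat \<Rightarrow> ('a list \<rightharpoonup> 'o) \<Rightarrow> ennreal" where
  "R0 m f =
     (INF A \<in> {A. zero_error m f A}. SUP z \<in> dom f. \<integral>\<^sup>+ T. of_nat (num_queries T z) \<partial>measure_pmf A)"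

datatype symbol = Bit bool | Star | Dagger

definition sabotaged :: "nat \<Rightarrow> (bool list \<times> bool) set \<Rightarrow> symbol \<Rightarrow> symbol list set" where
  "sabotaged m g s =
     {z. length z = m \<and> set z \<subseteq> {Bit False, Bit True, s} \<and>
         (\<exists>x\<in>strict_preimage g False. \<exists>y\<in>strict_preimage g True.
            \<forall>i<m. z ! i \<noteq> s \<longrightarrow> z ! i = Bit (x ! i) \<and> z ! i = Bit (y ! i))}"

lemma sabotaged_disjoint:
  assumes "g \<subseteq> {x. length x = m} \<times> UNIV"
  shows "sabotaged m g Star \<inter> sabotaged m g Dagger = {}"
proof (rule ccontr)
  assume "sabotaged m g Star \<inter> sabotaged m g Dagger \<noteq> {}"
  then obtain z where z: "z \<in> sabotaged m g Star" "z \<in> sabotaged m g Dagger" by blast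
  then have len: "length z = m" and no: "set z \<subseteq> {Bit False, Bit True}"
    by (auto simp: sabotaged_def)
  have ns: "z ! i \<noteq> Star" if "i < m" for i
    using subsetD[OF no nth_mem, of i] len that by auto
  obtain x y where xy: "x \<in> strict_preimage g False" "y \<in> strict_preimage g True"
    "\<forall>i<m. z ! i \<noteq> Star \<longrightarrow> z ! i = Bit (x ! i) \<and> z ! i = Bit (y ! i)"
    using z(1) by (auto simp: sabotaged_def)
  have "length x = m" "length y = m"
    using xy(1,2) assms by (auto simp: strict_preimage_def)
  moreover have "x ! i = y ! i" if "i < m" for i
    using xy(3) ns[OF that] that by (metis symbol.inject)
  ultimately have "x = y" by (intro nth_equalityI) auto
  with xy(1,2) show False by (auto simp: strict_preimage_def)
qed

text \<open>By \<open>sabotaged_disjoint\<close>, the order of the cases in \<open>g_sab\<close> is irrelevant.\<close>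

definition g_sab :: "nat \<Rightarrow> (bool list \<times> bool) set \<Rightarrow> (symbol list \<rightharpoonup> symbol)" where
  "g_sab m g z =
     (if z \<in> sabotaged m g Star then Some Star
      else if z \<in> sabotaged m g Dagger then Some Dagger
      else None)"

definition RS :: "nat \<Rightarrow> (bool list \<times> bool) set \<Rightarrow> ennreal" where
  "RS m g = R0 m (g_sab m g)"

end

theory Submission
  imports Defs
begin

text \<open>
  For point masses \<open>\<mu>\<^sub>0 = \<delta>\<^sub>x\<close> and \<open>\<mu>\<^sub>1 = \<delta>\<^sub>y\<close>, the conflict \<open>\<chi>(T, (\<mu>\<^sub>0, \<mu>\<^sub>1))\<close> is the number of queries after
  which \<open>T\<close> separates \<open>x\<close> from \<open>y\<close>. That is also the number of queries after which \<open>T\<close> hits a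
  sabotaged coordinate of the string that agrees with \<open>x\<close> and \<open>y\<close> wherever they coincide and is
  sabotaged elsewhere. Hence a distribution over trees computing \<open>g\<close> solves the sabotage problem at
  a cost bounded by its worst expected separation time, and the minimax theorem turns the best such
  distribution into a hard distribution over pairs \<open>(\<delta>\<^sub>x, \<delta>\<^sub>y)\<close>.
\<close>

section \<open>A minimax theorem with one finite side\<close>

text \<open>The convexity hypothesis of Ky Fan's minimax theorem, which needs no linear structure on \<open>X\<close>.\<close>

definition convexlike_on :: "'x set \<Rightarrow> ('x \<Rightarrow> real) set \<Rightarrow> bool" where
  "convexlike_on X F \<longleftrightarrow>
     (\<forall>x\<in>X. \<forall>y\<in>X. \<forall>t\<in>{0..1}. \<exists>z\<in>X. \<forall>f\<in>F. f z \<le> (1 - t) * f x + t * f y)"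

lemma convexlike_onD:
  assumes "convexlike_on X F" "x \<in> X" "y \<in> X" "0 \<le> t" "t \<le> 1"
  obtains z where "z \<in> X" "\<And>f. f \<in> F \<Longrightarrow> f z \<le> (1 - t) * f x + t * f y"
  using assms unfolding convexlike_on_def by (meson atLeastAtMost_iff)

lemma convexlike_on_sublevel:
  assumes "convexlike_on X (insert h F)"
  shows "convexlike_on {x\<in>X. h x < V} (insert h F)"
  unfolding convexlike_on_def
proof (intro ballI)
  fix x y and t :: real
  assume xy: "x \<in> {x\<in>X. h x < V}" "y \<in> {x\<in>X. h x < V}" and t: "t \<in> {0..1}"
  obtain z where z: "z \<in> X" "\<And>f. f \<in> insert h F \<Longrightarrow> f z \<le> (1 - t) * f x + t * f y"
    using convexlike_onD[OF assms, of x y t] xy t by auto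
  have "h z \<le> (1 - t) * h x + t * h y" using z(2) by simp
  also have "\<dots> < V" using xy t by (intro convex_bound_lt) auto
  finally show "\<exists>z\<in>{x\<in>X. h x < V}. \<forall>f\<in>insert h F. f z \<le> (1 - t) * f x + t * f y"
    using z by blast
qed

lemma convexlike_on_insert_expectation:
  fixes f :: "'i \<Rightarrow> 'x \<Rightarrow> real"
  assumes "convexlike_on X (insert h (f ` I))" and "finite I" and q: "set_pmf q \<subseteq> I"
  shows "convexlike_on X {h, \<lambda>x. measure_pmf.expectation q (\<lambda>i. f i x)}"
  unfolding convexlike_on_def
proof (intro ballI)
  let ?g = "\<lambda>x. measure_pmf.expectation q (\<lambda>i. f i x)"
  fix x y and t :: real
  assume xy: "x \<in> X" "y \<in> X" and t: "t \<in> {0..1}"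
  obtain z where z: "z \<in> X" "\<And>f'. f' \<in> insert h (f ` I) \<Longrightarrow> f' z \<le> (1 - t) * f' x + t * f' y"
    using convexlike_onD[OF assms(1) xy] t by auto
  have integrable: "integrable q u" for u :: "'i \<Rightarrow> real"
    using q \<open>finite I\<close> by (intro integrable_measure_pmf_finite) (rule finite_subset)
  have "?g z \<le> measure_pmf.expectation q (\<lambda>i. (1 - t) * f i x + t * f i y)"
    using q z(2) by (intro integral_mono_AE integrable) (auto simp: AE_measure_pmf_iff)
  also have "\<dots> = (1 - t) * ?g x + t * ?g y"
    by (subst Bochner_Integration.integral_add) (simp_all add: integrable)
  finally show "\<exists>z\<in>X. \<forall>f\<in>{h, ?g}. f z \<le> (1 - t) * f x + t * f y" using z by auto
qed

lemma affine_nonneg_on_positivesD: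
  fixes a b :: real
  assumes "\<And>r. 0 < r \<Longrightarrow> 0 \<le> a + r * b"
  shows "0 \<le> a" and "0 \<le> b"
proof -
  have "((\<lambda>r. a + r * b) \<longlongrightarrow> a + 0 * b) (at_right 0)" by (intro tendsto_intros)
  moreover have "\<forall>\<^sub>F r in at_right 0. 0 \<le> a + r * b"
    using eventually_at_right_less by (rule eventually_mono) (rule assms)
  ultimately have "0 \<le> a + 0 * b" by (rule tendsto_lowerbound) simp
  then show "0 \<le> a" by simp
  show "0 \<le> b"
  proof (rule ccontr)
    assume "\<not> 0 \<le> b"
    then show False using assms[of "(a + 1) / - b"] \<open>0 \<le> a\<close> by (simp add: field_simps)
  qed
qed

lemma linear_nonneg_on_open_quadrantD:
  fixes \<alpha> \<beta> a b :: real
  assumes nonneg: "\<And>r s. 0 < r \<Longrightarrow> 0 < s \<Longrightarrow> 0 \<le> \<alpha> * (a + r) + \<beta> * (b + s)"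
  shows "0 \<le> \<alpha>" and "0 \<le> \<beta>" and "0 \<le> \<alpha> * a + \<beta> * b"
proof -
  have "0 \<le> (\<alpha> * a + \<beta> * (b + 1)) + r * \<alpha>" if "0 < r" for r
    using nonneg[of r 1] that by (simp add: algebra_simps)
  then show "0 \<le> \<alpha>" by (rule affine_nonneg_on_positivesD)
  have "0 \<le> (\<alpha> * (a + 1) + \<beta> * b) + r * \<beta>" if "0 < r" for r
    using nonneg[of 1 r] that by (simp add: algebra_simps)
  then show "0 \<le> \<beta>" by (rule affine_nonneg_on_positivesD)
  have "0 \<le> (\<alpha> * a + \<beta> * b) + r * (\<alpha> + \<beta>)" if "0 < r" for r
    using nonneg[of r r] that by (simp add: algebra_simps)
  then show "0 \<le> \<alpha> * a + \<beta> * b" by (rule affine_nonneg_on_positivesD)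
qed

lemma convex_strictly_above_image:
  assumes "convexlike_on X {f, g}"
  shows "convex {p. \<exists>x\<in>X. f x < fst p \<and> g x < snd p}" (is "convex ?K")
  unfolding convex_alt
proof (intro ballI allI impI)
  fix p r and t :: real
  assume "p \<in> ?K" "r \<in> ?K" and t: "0 \<le> t \<and> t \<le> 1"
  then obtain x y where xy: "x \<in> X" "y \<in> X" and
    x: "f x < fst p" "g x < snd p" and y: "f y < fst r" "g y < snd r" by auto
  obtain z where z: "z \<in> X" "f z \<le> (1 - t) * f x + t * f y" "g z \<le> (1 - t) * g x + t * g y"
    using convexlike_onD[OF assms xy] t by (metis insertCI)
  have combination_less: "(1 - t) * a + t * b < (1 - t) * u + t * v" if "a < u" "b < v" for a b u v
    using convex_bound_lt[of "a - u" 0 "b - v" "1 - t" t] t that by (simp add: algebra_simps)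
  have "f z < fst ((1 - t) *\<^sub>R p + t *\<^sub>R r)" "g z < snd ((1 - t) *\<^sub>R p + t *\<^sub>R r)"
    using z(2,3) combination_less[OF x(1) y(1)] combination_less[OF x(2) y(2)] by simp_all
  then show "(1 - t) *\<^sub>R p + t *\<^sub>R r \<in> ?K" using z(1) by blast
qed

text \<open>
  A line separating \<open>(V, V)\<close> from the points strictly above the image of \<open>(f, g)\<close> has a nonnegative
  normal vector, which yields the weights.
\<close>

lemma convexlike_on_pair_combination:
  assumes convexlike: "convexlike_on X {f, g}" and large: "\<And>x. x \<in> X \<Longrightarrow> V \<le> f x \<or> V \<le> g x"
  obtains t where "0 \<le> t" "t \<le> 1" "\<And>x. x \<in> X \<Longrightarrow> V \<le> (1 - t) * f x + t * g x"
proof (cases "X = {}")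
  case True
  then show ?thesis using that[of 0] by simp
next
  case False
  then obtain x\<^sub>0 where x\<^sub>0: "x\<^sub>0 \<in> X" by blast
  define K where "K = {p. \<exists>x\<in>X. f x < fst p \<and> g x < snd p}"
  have K: "(f x + r, g x + s) \<in> K" if "x \<in> X" "0 < r" "0 < s" for x r s
    using that by (auto simp: K_def intro!: bexI[of _ x])
  have "convex K" unfolding K_def using convexlike by (rule convex_strictly_above_image)
  moreover have "{(V, V)} \<inter> K = {}" using large by (force simp: K_def)
  ultimately obtain \<alpha> \<beta> b where nonzero: "\<alpha> \<noteq> 0 \<or> \<beta> \<noteq> 0" and "\<alpha> * V + \<beta> * V \<le> b"
    and "\<And>u v. (u, v) \<in> K \<Longrightarrow> b \<le> \<alpha> * u + \<beta> * v"
    using separating_hyperplane_sets[of "{(V, V)}" K] K[OF x\<^sub>0, of 1 1]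
    by (force simp: inner_prod_def zero_prod_def)
  then have "\<alpha> * V + \<beta> * V \<le> \<alpha> * (f x + r) + \<beta> * (g x + s)" if "x \<in> X" "0 < r" "0 < s" for x r s
    using K[OF that] by (meson order_trans)
  then have above: "0 \<le> \<alpha> * (f x - V + r) + \<beta> * (g x - V + s)" if "x \<in> X" "0 < r" "0 < s" for x r s
    using that by (force simp: algebra_simps)
  note normal = linear_nonneg_on_open_quadrantD[OF above]
  have pos: "0 < \<alpha> + \<beta>" using nonzero normal(1,2)[OF x\<^sub>0] by linarith
  then have weight: "1 - \<beta> / (\<alpha> + \<beta>) = \<alpha> / (\<alpha> + \<beta>)" by (simp add: field_simps)
  have "V \<le> (1 - \<beta> / (\<alpha> + \<beta>)) * f x + \<beta> / (\<alpha> + \<beta>) * g x" if "x \<in> X" for x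
    unfolding weight using normal(3)[OF that] pos
    by (simp add: add_divide_distrib[symmetric] pos_le_divide_eq algebra_simps)
  then show ?thesis
    using that[of "\<beta> / (\<alpha> + \<beta>)"] pos normal(1,2)[OF x\<^sub>0] by simp
qed

definition mix_pmf :: "real \<Rightarrow> 'a pmf \<Rightarrow> 'a pmf \<Rightarrow> 'a pmf" where
  "mix_pmf t p q = bind_pmf (bernoulli_pmf t) (\<lambda>b. if b then q else p)"

lemma set_mix_pmf_subset: "set_pmf (mix_pmf t p q) \<subseteq> set_pmf p \<union> set_pmf q"
  by (auto simp: mix_pmf_def split: if_splits)

lemma expectation_mix_pmf:
  fixes f :: "'a \<Rightarrow> real"
  assumes "finite (set_pmf p)" "finite (set_pmf q)" "0 \<le> t" "t \<le> 1"
  shows "measure_pmf.expectation (mix_pmf t p q) f =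
    (1 - t) * measure_pmf.expectation p f + t * measure_pmf.expectation q f"
  unfolding mix_pmf_def using assms
  by (subst pmf_expectation_bind[of UNIV]) (auto simp: UNIV_bool)

lemma convexlike_on_finite_mixture:
  fixes f :: "'i \<Rightarrow> 'x \<Rightarrow> real"
  assumes "finite I" "I \<noteq> {}" "convexlike_on X (f ` I)" "\<And>x. x \<in> X \<Longrightarrow> \<exists>i\<in>I. V \<le> f i x"
  shows "\<exists>q. set_pmf q \<subseteq> I \<and> (\<forall>x\<in>X. V \<le> measure_pmf.expectation q (\<lambda>i. f i x))"
  using assms
proof (induction I arbitrary: X rule: finite_ne_induct)
  case (singleton i)
  then show ?case by (intro exI[of _ "return_pmf i"]) auto
next
  case (insert j I)
  \<comment> \<open>The points with \<open>f j x \<ge> V\<close> are handled by \<open>j\<close>, so the weights on \<open>I\<close> need only serve the others.\<close>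
  let ?X' = "{x\<in>X. f j x < V}"
  have "convexlike_on ?X' (f ` I)"
    using convexlike_on_sublevel[of X "f j" "f ` I"] insert.prems(1)
    unfolding convexlike_on_def by (simp, blast)
  moreover have "\<exists>i\<in>I. V \<le> f i x" if "x \<in> ?X'" for x
    using insert.prems(2)[of x] that by auto
  ultimately obtain q where q: "set_pmf q \<subseteq> I"
    "\<And>x. x \<in> ?X' \<Longrightarrow> V \<le> measure_pmf.expectation q (\<lambda>i. f i x)"
    using insert.IH by blast
  have "V \<le> f j x \<or> V \<le> measure_pmf.expectation q (\<lambda>i. f i x)" if "x \<in> X" for x
    using q(2)[of x] that by force
  moreover have "convexlike_on X {f j, \<lambda>x. measure_pmf.expectation q (\<lambda>i. f i x)}"
    using insert.prems(1) insert.hyps(1) q(1) by (intro convexlike_on_insert_expectation) auto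
  ultimately obtain t where t: "0 \<le> t" "t \<le> 1"
    "\<And>x. x \<in> X \<Longrightarrow> V \<le> (1 - t) * f j x + t * measure_pmf.expectation q (\<lambda>i. f i x)"
    using convexlike_on_pair_combination[of X "f j"] by metis
  have "set_pmf (mix_pmf t (return_pmf j) q) \<subseteq> insert j I"
    using set_mix_pmf_subset[of t "return_pmf j" q] q(1) by auto
  moreover have "V \<le> measure_pmf.expectation (mix_pmf t (return_pmf j) q) (\<lambda>i. f i x)"
    if "x \<in> X" for x
    using t that finite_subset[OF q(1) insert.hyps(1)] by (simp add: expectation_mix_pmf)
  ultimately show ?case by blast
qed

lemma nn_integral_pmf_finite_support:
  fixes f :: "'a \<Rightarrow> real"
  assumes "finite (set_pmf p)" "\<And>x. 0 \<le> f x"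
  shows "(\<integral>\<^sup>+x. ennreal (f x) \<partial>measure_pmf p) = ennreal (measure_pmf.expectation p f)"
  using assms by (intro nn_integral_eq_integral integrable_measure_pmf_finite) auto

lemma convexlike_on_finitely_supported_pmfs:
  fixes c :: "'i \<Rightarrow> 'a \<Rightarrow> real"
  shows "convexlike_on {p. finite (set_pmf p) \<and> set_pmf p \<subseteq> S}
    ((\<lambda>i p. measure_pmf.expectation p (c i)) ` I)"
    (is "convexlike_on ?X (?f ` I)")
  unfolding convexlike_on_def
proof (intro ballI)
  fix p q and t :: real
  assume pq: "p \<in> ?X" "q \<in> ?X" and t: "t \<in> {0..1}"
  then have "mix_pmf t p q \<in> ?X"
    using set_mix_pmf_subset[of t p q] by (auto intro: finite_subset)
  then show "\<exists>r\<in>?X. \<forall>f\<in>?f ` I. f r \<le> (1 - t) * f p + t * f q"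
    using pq t by (intro bexI[of _ "mix_pmf t p q"]) (auto simp: expectation_mix_pmf)
qed

theorem minimax_pmf:
  fixes c :: "'i \<Rightarrow> 'a \<Rightarrow> real"
  assumes fin: "finite I" and ne: "I \<noteq> {}" and nonneg: "\<And>i a. 0 \<le> c i a"
  shows "(INF p\<in>{p. set_pmf p \<subseteq> S}. SUP i\<in>I. \<integral>\<^sup>+a. ennreal (c i a) \<partial>measure_pmf p)
    \<le> (SUP q\<in>{q. set_pmf q \<subseteq> I}. INF a\<in>S. \<integral>\<^sup>+i. ennreal (c i a) \<partial>measure_pmf q)"
    (is "?upper \<le> ?lower")
proof (rule dense_le)
  fix U assume U: "U < ?upper"
  then obtain V where V: "U = ennreal V" using top.not_eq_extremum by (cases U) auto
  \<comment> \<open>Finite support keeps all expectations finite although \<open>c i\<close> may be unbounded.\<close>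
  define X where "X = {p. finite (set_pmf p) \<and> set_pmf p \<subseteq> S}"
  let ?f = "\<lambda>i p. measure_pmf.expectation p (c i)"
  have "convexlike_on X (?f ` I)"
    unfolding X_def by (rule convexlike_on_finitely_supported_pmfs)
  moreover have "\<exists>i\<in>I. V \<le> ?f i p" if p: "p \<in> X" for p
  proof -
    have "U < (SUP i\<in>I. \<integral>\<^sup>+a. ennreal (c i a) \<partial>measure_pmf p)"
      using U p by (auto simp: X_def intro: less_le_trans INF_lower)
    then obtain i where "i \<in> I" "ennreal V < ennreal (?f i p)"
      using p nonneg by (auto simp: less_SUP_iff V X_def nn_integral_pmf_finite_support)
    then show ?thesis by (meson ennreal_leI leD linear)
  qed
  ultimately obtain q where q: "set_pmf q \<subseteq> I"
    "\<And>p. p \<in> X \<Longrightarrow> V \<le> measure_pmf.expectation q (\<lambda>i. ?f i p)"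
    using convexlike_on_finite_mixture[OF fin ne] by blast
  have "U \<le> (\<integral>\<^sup>+i. ennreal (c i a) \<partial>measure_pmf q)" if "a \<in> S" for a
    using q(2)[of "return_pmf a"] that finite_subset[OF q(1) fin] nonneg
    by (simp add: V X_def nn_integral_pmf_finite_support ennreal_leI)
  then show "U \<le> ?lower" using q(1) by (intro SUP_upper2[of q] INF_greatest) auto
qed

section \<open>Separating conflicting inputs\<close>

definition conflicting_pairs :: "(bool list \<times> bool) set \<Rightarrow> (bool list \<times> bool list) set" where
  "conflicting_pairs g = strict_preimage g False \<times> strict_preimage g True"

lemma length_conflicting_pairs:
  assumes "g \<subseteq> {x. length x = m} \<times> UNIV" "(x, y) \<in> conflicting_pairs g"
  shows "length x = m" "length y = m"
  using assms by (auto simp: conflicting_pairs_def strict_preimage_def)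

lemma finite_conflicting_pairs:
  assumes "g \<subseteq> {x. length x = m} \<times> UNIV"
  shows "finite (conflicting_pairs g)"
proof (rule finite_subset)
  show "conflicting_pairs g \<subseteq> {x. length x = m} \<times> {x. length x = m}"
    using length_conflicting_pairs[OF assms] by auto
  show "finite ({x :: bool list. length x = m} \<times> {x :: bool list. length x = m})"
    using finite_lists_length_eq[of "UNIV :: bool set" m] by simp
qed

definition separates :: "nat \<Rightarrow> (bool, 'o) dtree \<Rightarrow> (bool list \<times> bool) set \<Rightarrow> bool" where
  "separates m T g \<longleftrightarrow> valid_dtree m T \<and> (\<forall>(x, y)\<in>conflicting_pairs g. run T x \<noteq> run T y)"

lemma computes_imp_separates: "computes m T g \<Longrightarrow> separates m T g"
  by (auto simp: computes_def separates_def conflicting_pairs_def)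

primrec separation_time :: "('a, 'o) dtree \<Rightarrow> 'a list \<Rightarrow> 'a list \<Rightarrow> nat" where
  "separation_time (Leaf b) x y = 0"
| "separation_time (Query i k) x y =
     (if x ! i = y ! i then Suc (separation_time (k (x ! i)) x y) else 1)"

section \<open>Sabotage complexity is at most the expected separation time\<close>

text \<open>The output at a leaf is arbitrary: a separating tree meets a sabotaged coordinate before it stops.\<close>

primrec sabotage_tree :: "(bool, 'o) dtree \<Rightarrow> (symbol, symbol) dtree" where
  "sabotage_tree (Leaf b) = Leaf Star"
| "sabotage_tree (Query i k) =
     Query i (\<lambda>s. case s of Bit b \<Rightarrow> sabotage_tree (k b) | Star \<Rightarrow> Leaf Star | Dagger \<Rightarrow> Leaf Dagger)"

lemma valid_sabotage_tree: "valid_dtree m T \<Longrightarrow> valid_dtree m (sabotage_tree T)"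
  by (induction T) (auto split: symbol.splits)

definition hides_conflicts :: "nat \<Rightarrow> symbol \<Rightarrow> bool list \<Rightarrow> bool list \<Rightarrow> symbol list \<Rightarrow> bool" where
  "hides_conflicts m s x y z \<longleftrightarrow> (\<forall>i<m. z ! i \<noteq> s \<longrightarrow> z ! i = Bit (x ! i) \<and> z ! i = Bit (y ! i))"

lemma g_sab_eq_SomeE:
  assumes "g_sab m g z = Some s"
  obtains x y where "(x, y) \<in> conflicting_pairs g" "s \<in> {Star, Dagger}" "hides_conflicts m s x y z"
proof -
  have "s \<in> {Star, Dagger}" "z \<in> sabotaged m g s"
    using assms by (auto simp: g_sab_def split: if_splits)
  then show ?thesis
    using that by (auto simp: sabotaged_def conflicting_pairs_def hides_conflicts_def)
qed

lemma sabotage_tree_detects_symbol: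
  assumes "valid_dtree m T" "run T x \<noteq> run T y" and s: "s \<in> {Star, Dagger}"
    and hides: "hides_conflicts m s x y z"
  shows "run (sabotage_tree T) z = s \<and> num_queries (sabotage_tree T) z \<le> separation_time T x y"
  using assms(1,2)
proof (induction T)
  case (Leaf b)
  then show ?case by simp
next
  case (Query i k)
  show ?case
  proof (cases "z ! i = s")
    case True
    then show ?thesis using s by auto
  next
    case False
    then have z: "z ! i = Bit (x ! i)" "z ! i = Bit (y ! i)"
      using hides Query.prems(1) by (simp_all add: hides_conflicts_def)
    then show ?thesis using Query.IH[of "k (x ! i)"] Query.prems by auto
  qed
qed

lemma sabotage_tree_solves_g_sab:
  assumes "g_sab m g z = Some s"
  obtains x y where "(x, y) \<in> conflicting_pairs g"
    "\<And>T :: (bool, 'o) dtree. separates m T g \<Longrightarrow>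
       run (sabotage_tree T) z = s \<and> num_queries (sabotage_tree T) z \<le> separation_time T x y"
proof -
  obtain x y where xy: "(x, y) \<in> conflicting_pairs g" "s \<in> {Star, Dagger}" "hides_conflicts m s x y z"
    using assms by (rule g_sab_eq_SomeE)
  show ?thesis
  proof (rule that[OF xy(1)])
    fix T :: "(bool, 'o) dtree" assume "separates m T g"
    then show "run (sabotage_tree T) z = s \<and> num_queries (sabotage_tree T) z \<le> separation_time T x y"
      using xy by (intro sabotage_tree_detects_symbol) (auto simp: separates_def)
  qed
qed

lemma RS_le_expected_separation_time:
  assumes separates: "\<And>T. T \<in> set_pmf p \<Longrightarrow> separates m T g"
  shows "RS m g \<le>
    (SUP (x, y)\<in>conflicting_pairs g. \<integral>\<^sup>+T. of_nat (separation_time T x y) \<partial>measure_pmf p)"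
    (is "_ \<le> ?bound")
proof -
  let ?A = "map_pmf sabotage_tree p"
  have "zero_error m (g_sab m g) ?A"
    unfolding zero_error_def
  proof (intro ballI conjI)
    fix T assume "T \<in> set_pmf ?A"
    then obtain T' where "T' \<in> set_pmf p" and T: "T = sabotage_tree T'" by auto
    then have T': "separates m T' g" by (intro separates)
    then show "valid_dtree m T" by (simp add: T separates_def valid_sabotage_tree)
    fix z assume "z \<in> dom (g_sab m g)"
    then obtain s where "g_sab m g z = Some s" by blast
    then show "g_sab m g z = Some (run T z)"
      using T T' by (metis sabotage_tree_solves_g_sab)
  qed
  then have "RS m g \<le> (SUP z\<in>dom (g_sab m g). \<integral>\<^sup>+T. of_nat (num_queries T z) \<partial>measure_pmf ?A)"
    unfolding RS_def R0_def by (intro INF_lower) simp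
  also have "\<dots> \<le> ?bound"
  proof (rule SUP_least)
    fix z assume "z \<in> dom (g_sab m g)"
    then obtain s where "g_sab m g z = Some s" by blast
    then obtain x y where xy: "(x, y) \<in> conflicting_pairs g"
      "\<And>T. T \<in> set_pmf p \<Longrightarrow> num_queries (sabotage_tree T) z \<le> separation_time T x y"
      using separates by (metis sabotage_tree_solves_g_sab)
    have "(\<integral>\<^sup>+T. of_nat (num_queries T z) \<partial>measure_pmf ?A)
        \<le> (\<integral>\<^sup>+T. of_nat (separation_time T x y) \<partial>measure_pmf p)"
      using xy(2) by (auto simp: AE_measure_pmf_iff intro!: nn_integral_mono_AE)
    then show "(\<integral>\<^sup>+T. of_nat (num_queries T z) \<partial>measure_pmf ?A) \<le> ?bound"
      using xy(1) by (intro SUP_upper2[of "(x, y)"]) auto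
  qed
  finally show ?thesis .
qed

section \<open>The conflict complexity of a pair of point masses\<close>

lemma finite_vertices: "finite (vertices (T :: ('a::finite, 'o) dtree))"
  by (induction T) auto

lemma separating_vertex:
  assumes "run T x \<noteq> run T y"
  shows "\<exists>v\<in>internal_vertices T. vertex_depth v = separation_time T x y \<and>
    reaches T x v \<and> reaches T y v \<and> x ! query_at T v \<noteq> y ! query_at T v"
  using assms
proof (induction T)
  case (Leaf b)
  then show ?case by simp
next
  case (Query i k)
  show ?case
  proof (cases "x ! i = y ! i")
    case False
    then show ?thesis
      by (intro bexI[of _ "[]"]) (auto simp: internal_vertices_def vertex_depth_def query_at_def)
  next
    case True
    then obtain v where "v \<in> internal_vertices (k (x ! i))"
      "vertex_depth v = separation_time (k (x ! i)) x y" "reaches (k (x ! i)) x v"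
      "reaches (k (x ! i)) y v" "x ! query_at (k (x ! i)) v \<noteq> y ! query_at (k (x ! i)) v"
      using Query.IH[of "k (x ! i)"] Query.prems by auto
    with True show ?thesis
      by (intro bexI[of _ "(x ! i) # v"]) (auto simp: internal_vertices_def vertex_depth_def query_at_def)
  qed
qed

lemma reaches_appendD: "reaches T x (v @ w) \<Longrightarrow> reaches T x v"
  by (induction T x v rule: reaches.induct) auto

lemma conflict_R_Nil: "conflict_R m T \<mu>\<^sub>0 \<mu>\<^sub>1 [] = 1"
  by (subst conflict_R.simps) simp

lemma conflict_R_snoc:
  "conflict_R m T \<mu>\<^sub>0 \<mu>\<^sub>1 (v @ [a]) = conflict_R m T \<mu>\<^sub>0 \<mu>\<^sub>1 v *
     min \<P>(x in \<mu>\<^sub>0. x \<in> subcube m T (v @ [a]) \<bar> x \<in> subcube m T v)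
         \<P>(x in \<mu>\<^sub>1. x \<in> subcube m T (v @ [a]) \<bar> x \<in> subcube m T v)"
  by (subst conflict_R.simps) simp

lemma conflict_R_nonneg: "0 \<le> conflict_R m T \<mu>\<^sub>0 \<mu>\<^sub>1 v"
  by (induction v rule: rev_induct) (simp_all add: conflict_R_Nil conflict_R_snoc cond_prob_def)

lemma cond_prob_return:
  assumes "x \<in> S" "Q x"
  shows "\<P>(x in return (count_space S) x. P x \<bar> Q x) = (if P x then 1 else 0)"
  using assms by (simp add: cond_prob_def measure_return indicator_def)

lemma conflict_R_return:
  assumes "x \<in> S\<^sub>0" "y \<in> S\<^sub>1" "length x = m" "length y = m" "reaches T x v" "reaches T y v"
  shows "conflict_R m T (return (count_space S\<^sub>0) x) (return (count_space S\<^sub>1) y) v = 1"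
  using assms(5,6)
proof (induction v rule: rev_induct)
  case Nil
  then show ?case by (simp add: conflict_R_Nil)
next
  case (snoc a v)
  then have "reaches T x v" "reaches T y v" by (blast dest: reaches_appendD)+
  with snoc assms(1-4) show ?case
    by (simp add: conflict_R_snoc cond_prob_return subcube_def)
qed

lemma separation_time_le_conflict_chi_return:
  assumes xy: "x \<in> S\<^sub>0" "y \<in> S\<^sub>1" "length x = m" "length y = m" and run: "run T x \<noteq> run T y"
  shows "real (separation_time T x y)
    \<le> conflict_chi m T (return (count_space S\<^sub>0) x) (return (count_space S\<^sub>1) y)"
proof -
  let ?\<mu>\<^sub>0 = "return (count_space S\<^sub>0) x" and ?\<mu>\<^sub>1 = "return (count_space S\<^sub>1) y"
  let ?term = "\<lambda>v. real (vertex_depth v) * conflict_Delta m T ?\<mu>\<^sub>0 ?\<mu>\<^sub>1 v * conflict_R m T ?\<mu>\<^sub>0 ?\<mu>\<^sub>1 v"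
  obtain v where v: "v \<in> internal_vertices T" "vertex_depth v = separation_time T x y"
    "reaches T x v" "reaches T y v" "x ! query_at T v \<noteq> y ! query_at T v"
    using separating_vertex[OF run] by blast
  have "conflict_Delta m T ?\<mu>\<^sub>0 ?\<mu>\<^sub>1 v = 1"
    using v xy by (auto simp: conflict_Delta_def prob_zero_def cond_prob_return subcube_def)
  then have "real (separation_time T x y) = ?term v"
    using v conflict_R_return[OF xy v(3,4)] by simp
  also have "\<dots> \<le> (\<Sum>v\<in>internal_vertices T. ?term v)"
    using v(1) finite_vertices[of T]
    by (intro member_le_sum) (auto simp: internal_vertices_def conflict_Delta_def conflict_R_nonneg)
  finally show ?thesis by (simp add: conflict_chi_def)
qed

section \<open>Expected separation time is at most the max conflict complexity\<close>

lemma measurable_cond_prob_prob_algebra: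
  "(\<lambda>\<mu>. \<P>(x in \<mu>. P x \<bar> Q x)) \<in> borel_measurable (prob_algebra (count_space S))"
proof -
  have "(\<lambda>\<mu>. measure \<mu> {x\<in>S. P x \<and> Q x} / measure \<mu> {x\<in>S. Q x})
      \<in> borel_measurable (prob_algebra (count_space S))"
    by (intro borel_measurable_divide measurable_measure_prob_algebra) auto
  also have "?this \<longleftrightarrow> ?thesis"
  proof (intro measurable_cong)
    fix \<mu> assume "\<mu> \<in> space (prob_algebra (count_space S))"
    then have "space \<mu> = S"
      using sets_eq_imp_space_eq[of \<mu> "count_space S"] by (simp add: space_prob_algebra)
    then show "measure \<mu> {x\<in>S. P x \<and> Q x} / measure \<mu> {x\<in>S. Q x} = \<P>(x in \<mu>. P x \<bar> Q x)"
      by (simp add: cond_prob_def)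
  qed
  finally show ?thesis .
qed

lemma measurable_conflict_chi:
  "(\<lambda>(\<mu>\<^sub>0, \<mu>\<^sub>1). conflict_chi m T \<mu>\<^sub>0 \<mu>\<^sub>1) \<in> borel_measurable (distribution_pairs g)"
proof -
  have fst: "(\<lambda>p. \<P>(x in fst p. P x \<bar> Q x)) \<in> borel_measurable (distribution_pairs g)" for P Q
    unfolding distribution_pairs_def
    by (rule measurable_compose[OF measurable_fst measurable_cond_prob_prob_algebra])
  have snd: "(\<lambda>p. \<P>(x in snd p. P x \<bar> Q x)) \<in> borel_measurable (distribution_pairs g)" for P Q
    unfolding distribution_pairs_def
    by (rule measurable_compose[OF measurable_snd measurable_cond_prob_prob_algebra])
  have R: "(\<lambda>p. conflict_R m T (fst p) (snd p) v) \<in> borel_measurable (distribution_pairs g)" for v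
  proof (induction v rule: rev_induct)
    case Nil
    show ?case by (simp add: conflict_R_Nil)
  next
    case (snoc a v)
    then show ?case
      unfolding conflict_R_snoc by (intro borel_measurable_times borel_measurable_min fst snd)
  qed
  show ?thesis
    unfolding conflict_chi_def conflict_Delta_def prob_zero_def case_prod_beta
    by (intro borel_measurable_sum borel_measurable_times borel_measurable_abs
        borel_measurable_diff borel_measurable_const fst snd R)
qed

text \<open>
  The measurable space of a \<^type>\<open>pmf\<close> is the whole type, so the restriction to the support is what
  makes \<open>h\<close> measurable when it is only known to map the support into \<open>space N\<close>.
\<close>

definition distr_pmf :: "'b measure \<Rightarrow> ('a \<Rightarrow> 'b) \<Rightarrow> 'a pmf \<Rightarrow> 'b measure" where
  "distr_pmf N h p = distr (restrict_space (measure_pmf p) (set_pmf p)) N h"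

lemma measurable_restrict_space_set_pmf:
  assumes "h ` set_pmf p \<subseteq> space N"
  shows "h \<in> measurable (restrict_space (measure_pmf p) (set_pmf p)) N"
  using assms by (auto simp: measurable_def space_restrict_space sets_restrict_space)

lemma distr_pmf_in_prob_algebra:
  assumes "h ` set_pmf p \<subseteq> space N"
  shows "distr_pmf N h p \<in> space (prob_algebra N)"
proof -
  have "prob_space (restrict_space (measure_pmf p) (set_pmf p))"
    by (rule prob_spaceI) (simp add: space_restrict_space emeasure_restrict_space emeasure_pmf)
  then show ?thesis
    using prob_space.prob_space_distr[OF _ measurable_restrict_space_set_pmf[OF assms]]
    by (simp add: distr_pmf_def space_prob_algebra)
qed

lemma nn_integral_distr_pmf:
  assumes "h ` set_pmf p \<subseteq> space N" "f \<in> borel_measurable N"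
  shows "(\<integral>\<^sup>+y. f y \<partial>distr_pmf N h p) = (\<integral>\<^sup>+x. f (h x) \<partial>measure_pmf p)"
proof -
  have "(\<integral>\<^sup>+y. f y \<partial>distr_pmf N h p) = (\<integral>\<^sup>+x. f (h x) * indicator (set_pmf p) x \<partial>measure_pmf p)"
    unfolding distr_pmf_def using measurable_restrict_space_set_pmf[OF assms(1)] assms(2)
    by (simp add: nn_integral_distr nn_integral_restrict_space)
  also have "\<dots> = (\<integral>\<^sup>+x. f (h x) \<partial>measure_pmf p)"
    by (intro nn_integral_cong_AE) (simp add: AE_measure_pmf_iff)
  finally show ?thesis .
qed

definition point_masses ::
  "(bool list \<times> bool) set \<Rightarrow> bool list \<times> bool list \<Rightarrow> bool list measure \<times> bool list measure" where
  "point_masses g = (\<lambda>(x, y). (return (count_space (strict_preimage g False)) x,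
     return (count_space (strict_preimage g True)) y))"

lemma point_masses_in_distribution_pairs:
  "point_masses g ` conflicting_pairs g \<subseteq> space (distribution_pairs g)"
  by (auto simp: point_masses_def conflicting_pairs_def distribution_pairs_def space_pair_measure
      space_prob_algebra intro!: prob_space_return)

lemma expected_separation_time_le_max_conflict:
  assumes dom: "g \<subseteq> {x. length x = m} \<times> UNIV" and q: "set_pmf q \<subseteq> conflicting_pairs g"
  shows "(INF T\<in>{T. computes m T g}. \<integral>\<^sup>+(x, y). of_nat (separation_time T x y) \<partial>measure_pmf q)
    \<le> max_conflict m g"
proof -
  let ?Q = "distr_pmf (distribution_pairs g) (point_masses g) q"
  have point_masses: "point_masses g ` set_pmf q \<subseteq> space (distribution_pairs g)"
    using q point_masses_in_distribution_pairs by blast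
  have "(\<integral>\<^sup>+(x, y). of_nat (separation_time T x y) \<partial>measure_pmf q) \<le> conflict_chi_avg m T ?Q"
    if T: "computes m T g" for T
  proof -
    let ?chi = "\<lambda>(\<mu>\<^sub>0, \<mu>\<^sub>1). ennreal (conflict_chi m T \<mu>\<^sub>0 \<mu>\<^sub>1)"
    have "of_nat (separation_time T x y) \<le> ?chi (point_masses g (x, y))"
      if xy: "(x, y) \<in> conflicting_pairs g" for x y
    proof -
      have "run T x \<noteq> run T y"
        using computes_imp_separates[OF T] xy by (auto simp: separates_def)
      then have "ennreal (real (separation_time T x y)) \<le> ?chi (point_masses g (x, y))"
        using xy length_conflicting_pairs[OF dom xy]
        by (auto simp: point_masses_def conflicting_pairs_def
            intro!: ennreal_leI separation_time_le_conflict_chi_return)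
      then show ?thesis by (simp add: ennreal_of_nat_eq_real_of_nat)
    qed
    then have "(\<integral>\<^sup>+(x, y). of_nat (separation_time T x y) \<partial>measure_pmf q)
        \<le> (\<integral>\<^sup>+i. ?chi (point_masses g i) \<partial>measure_pmf q)"
      using q by (intro nn_integral_mono_AE) (auto simp: AE_measure_pmf_iff)
    also have "\<dots> = conflict_chi_avg m T ?Q"
      unfolding conflict_chi_avg_def
      using measurable_compose[OF measurable_conflict_chi measurable_ennreal]
      by (subst nn_integral_distr_pmf[OF point_masses]) (simp_all add: case_prod_unfold)
    finally show ?thesis .
  qed
  then have "(INF T\<in>{T. computes m T g}. \<integral>\<^sup>+(x, y). of_nat (separation_time T x y) \<partial>measure_pmf q)
      \<le> (INF T\<in>{T. computes m T g}. conflict_chi_avg m T ?Q)"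
    by (intro INF_mono) auto
  also have "\<dots> \<le> max_conflict m g"
    unfolding max_conflict_def using distr_pmf_in_prob_algebra[OF point_masses] by (rule SUP_upper)
  finally show ?thesis .
qed

theorem theorem4:
  fixes m :: nat and g :: "(bool list \<times> bool) set"
  assumes "g \<subseteq> {x. length x = m} \<times> UNIV"
  shows "max_conflict m g \<ge> RS m g"
proof (cases "conflicting_pairs g = {}")
  case True
  then show ?thesis
    using RS_le_expected_separation_time[of "return_pmf (Leaf ())" m g]
    by (simp add: separates_def bot_ennreal)
next
  case False
  let ?trees = "{T. computes m T g}" and ?pairs = "conflicting_pairs g"
  have "RS m g \<le> (INF p\<in>{p. set_pmf p \<subseteq> ?trees}.
      SUP (x, y)\<in>?pairs. \<integral>\<^sup>+T. of_nat (separation_time T x y) \<partial>measure_pmf p)"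
    by (intro INF_greatest RS_le_expected_separation_time computes_imp_separates) auto
  also have "\<dots> \<le> (SUP q\<in>{q. set_pmf q \<subseteq> ?pairs}.
      INF T\<in>?trees. \<integral>\<^sup>+(x, y). of_nat (separation_time T x y) \<partial>measure_pmf q)"
    using minimax_pmf[OF finite_conflicting_pairs[OF assms] False,
        of "\<lambda>(x, y) T. real (separation_time T x y)" ?trees]
    by (simp add: case_prod_unfold ennreal_of_nat_eq_real_of_nat)
  also have "\<dots> \<le> max_conflict m g"
    using expected_separation_time_le_max_conflict[OF assms] by (intro SUP_least) auto
  finally show ?thesis .
qed

end
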